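(* Let $a,b,\alpha,\beta,r$ be positive constants with $a>b+\alpha$. Let $v:[-r,\infty)\rightarrow\mathbb{R}^+$ be a continuous function satisfying $$\mathrm{D}^+ v(t)\leq -a\, v(t)+b\sup_{-r\leq s\leq 0}\{v(t+s)\}+\alpha\,\|v_0\|_r\, e^{-\beta t}\qquad\text{for all } t\in\mathbb{R}^+,$$ where $\|v_0\|_r=\sup_{-r\leq s\leq 0}\{v(s)\}$. Then $$v(t)\leq \|v_0\|_r\, e^{-\eta t}\qquad\text{for all } t\in\mathbb{R}^+,$$ where $\eta=\min\{\lambda,\beta\}$ and $\lambda$ is the real solution of the equation $a=b e^{\lambda r}+\lambda+\alpha$.
   Context: $\mathbb{R}^+$ denotes the set of non-negative reals. For a real-valued function $W$, the upper (right) Dini derivative is $\mathrm{D}^+W(t)=\limsup_{\Delta t\to 0^+}\frac{W(t+\Delta t)-W(t)}{\Delta t}$. *)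

theory Defs
  imports Complex_Main "HOL-Library.Extended_Real"
begin

text \<open>The upper right Dini derivative. It is extended-real-valued, since the limes superior of
  the difference quotients may be infinite.\<close>

definition upper_Dini :: "(real \<Rightarrow> real) \<Rightarrow> real \<Rightarrow> ereal" where
  "upper_Dini W t = Limsup (at_right 0) (\<lambda>h. ereal ((W (t + h) - W t) / h))"

text \<open>The size \<open>\<parallel>v\<^sub>0\<parallel>\<^sub>r\<close> of the initial segment. No absolute value is taken, as it is only applied
  to functions that are non-negative on \<open>[-r, \<infinity>)\<close>.\<close>

definition init_norm :: "real \<Rightarrow> (real \<Rightarrow> real) \<Rightarrow> real" where
  "init_norm r v = (SUP s\<in>{-r..0}. v s)"

end

theory Submission
  imports Defs
begin

text \<open>The idea is to compare \<open>v\<close> with the exponentials \<open>w t = K * exp (- \<eta> * t)\<close>, for a constant \<open>K\<close>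
  slightly larger than \<open>N = init_norm r v\<close>. The equation for \<open>\<lambda>\<close> is chosen so that \<open>w\<close> is a strict
  supersolution of the delay inequality. Since \<open>\<eta> \<le> \<lambda>\<close>, one has \<open>b * exp (\<eta> * r) + \<eta> + \<alpha> \<le> a\<close>; so
  if \<open>v \<le> w\<close> up to a time \<open>t\<close> at which \<open>v t = w t\<close>, the delayed supremum is at most
  \<open>w (t - r) = exp (\<eta> * r) * w t\<close>, the forcing term is less than \<open>\<alpha> * w t\<close> because \<open>\<eta> \<le> \<beta>\<close> and
  \<open>N < K\<close>, and hence the Dini derivative of \<open>v\<close> at \<open>t\<close> is strictly less than \<open>- \<eta> * w t\<close>, the slope
  of \<open>w\<close>. By \<open>Dini_comparison\<close> this prevents \<open>v\<close> from ever rising above \<open>w\<close>. Letting \<open>K\<close>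
  decrease to \<open>N\<close> gives the claim.

  The strict inequality is why \<open>K > N\<close> is needed: with \<open>K = N\<close> the slopes of \<open>v\<close> and \<open>w\<close> at a
  contact point may agree, which says nothing about their order afterwards.\<close>

lemma upper_Dini_less_imp_eventually_less:
  assumes "upper_Dini v t < ereal D" and "(w has_real_derivative D) (at t)" and "v t \<le> w t"
  shows "eventually (\<lambda>h. v (t + h) < w (t + h)) (at_right 0)"
proof -
  obtain c where c: "upper_Dini v t < ereal c" "c < D"
    using ereal_dense2[OF assms(1)] by auto
  have v: "eventually (\<lambda>h. (v (t + h) - v t) / h < c) (at_right 0)"
    using Limsup_lessD[OF c(1)[unfolded upper_Dini_def]] by simp
  have "((\<lambda>h. (w (t + h) - w t) / h) \<longlongrightarrow> D) (at_right 0)"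
    using assms(2) unfolding DERIV_def by (rule filterlim_mono) (auto simp: at_le)
  then have w: "eventually (\<lambda>h. c < (w (t + h) - w t) / h) (at_right 0)"
    using c(2) by (rule order_tendstoD)
  have "eventually (\<lambda>h::real. h > 0) (at_right 0)"
    by (simp add: eventually_at_right_less)
  with v w show ?thesis
  proof eventually_elim
    case (elim h)
    then have "(v (t + h) - v t) / h < (w (t + h) - w t) / h" by simp
    with \<open>h > 0\<close> have "v (t + h) - v t < w (t + h) - w t"
      by (simp add: divide_less_cancel)
    with assms(3) show ?case by simp
  qed
qed

text \<open>At the infimum of the times with \<open>v > w\<close>, continuity gives \<open>v \<le> w\<close>, and \<open>v < w\<close> holds
  immediately afterwards: by continuity if the inequality is strict there, and by the slope
  condition at a contact point. Such an infimum can therefore not exist. A right derivative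
  controls only the future, so the argument has to look at the infimum of the times of strict
  excess; at a first time of contact, \<open>v\<close> could touch \<open>w\<close> and fall again.\<close>

lemma Dini_comparison:
  fixes v w w' :: "real \<Rightarrow> real"
  assumes cont: "continuous_on {0..} v"
    and deriv: "\<And>t. t \<ge> 0 \<Longrightarrow> (w has_real_derivative w' t) (at t)"
    and init: "v 0 \<le> w 0"
    and contact: "\<And>t. \<lbrakk>t \<ge> 0; \<And>s. s \<in> {0..t} \<Longrightarrow> v s \<le> w s; v t = w t\<rbrakk>
                    \<Longrightarrow> upper_Dini v t < ereal (w' t)"
    and "x \<ge> 0"
  shows "v x \<le> w x"
proof (rule ccontr)
  assume "\<not> v x \<le> w x"
  define S where "S = {s. s \<ge> 0 \<and> w s < v s}"
  define t where "t = Inf S"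
  have S: "S \<noteq> {}" "bdd_below S"
    using \<open>x \<ge> 0\<close> \<open>\<not> v x \<le> w x\<close> by (auto simp: S_def intro: bdd_belowI[of _ 0])
  have "t \<ge> 0"
    unfolding t_def using S(1) by (rule cInf_greatest) (simp add: S_def)
  have below: "v s \<le> w s" if "0 \<le> s" "s < t" for s
    using that cInf_lower[OF _ S(2), of s] by (force simp: S_def t_def)
  have lim_v: "(v \<longlongrightarrow> v t) (at t within {0..})"
    using cont \<open>t \<ge> 0\<close> by (auto simp: continuous_on_def)
  have lim_w: "(w \<longlongrightarrow> w t) (at t within {0..})"
    using DERIV_isCont[OF deriv[OF \<open>t \<ge> 0\<close>]] unfolding isCont_def by (rule tendsto_within_subset) simp
  have lim: "((\<lambda>s. v s - w s) \<longlongrightarrow> v t - w t) (at t within {0..})"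
    using lim_v lim_w by (rule tendsto_diff)
  have at_t: "v t \<le> w t"
  proof (rule ccontr)
    assume "\<not> v t \<le> w t"
    with init \<open>t \<ge> 0\<close> have "t > 0" by (cases "t = 0") auto
    have "eventually (\<lambda>s. 0 < v s - w s) (at t within {0..})"
      using lim by (rule order_tendstoD) (use \<open>\<not> v t \<le> w t\<close> in simp)
    then obtain d where d: "d > 0"
      "\<And>s. s \<ge> 0 \<Longrightarrow> s \<noteq> t \<Longrightarrow> dist s t < d \<Longrightarrow> 0 < v s - w s"
      unfolding eventually_at by auto
    define s where "s = t - min d t / 2"
    have "0 \<le> s" "s < t" "dist s t < d"
      using \<open>t > 0\<close> \<open>d > 0\<close> by (auto simp: s_def dist_real_def min_def)
    with d(2)[of s] below[of s] show False by simp
  qed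
  have "eventually (\<lambda>h. v (t + h) < w (t + h)) (at_right 0)"
  proof (cases "v t = w t")
    case True
    have "v s \<le> w s" if "s \<in> {0..t}" for s
      using that below[of s] at_t by (cases "s = t") auto
    with contact True \<open>t \<ge> 0\<close> have "upper_Dini v t < ereal (w' t)" by blast
    then show ?thesis
      using deriv[OF \<open>t \<ge> 0\<close>] at_t by (rule upper_Dini_less_imp_eventually_less)
  next
    case False
    have "eventually (\<lambda>s. v s - w s < 0) (at t within {0..})"
      using lim by (rule order_tendstoD) (use False at_t in simp)
    then obtain d where d: "d > 0"
      "\<And>s. s \<ge> 0 \<Longrightarrow> s \<noteq> t \<Longrightarrow> dist s t < d \<Longrightarrow> v s - w s < 0"
      unfolding eventually_at by auto
    have "v (t + h) < w (t + h)" if "0 < h" "h < d" for h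
      using d(2)[of "t + h"] that \<open>t \<ge> 0\<close> by (simp add: dist_real_def)
    with d(1) show ?thesis unfolding eventually_at_right_field by auto
  qed
  then obtain d where d: "d > 0" "\<And>h. 0 < h \<Longrightarrow> h < d \<Longrightarrow> v (t + h) < w (t + h)"
    unfolding eventually_at_right_field by auto
  have "t + d \<le> s" if "s \<in> S" for s
  proof (rule ccontr)
    assume "\<not> t + d \<le> s"
    moreover have "t \<le> s" using cInf_lower[OF that S(2)] by (simp add: t_def)
    ultimately have "v s \<le> w s"
      using d(2)[of "s - t"] at_t by (cases "s = t") auto
    with that show False by (simp add: S_def)
  qed
  then have "t + d \<le> t" unfolding t_def using S(1) by (intro cInf_greatest) auto
  with d(1) show False by simp
qed

lemma bdd_above_image_Icc:
  fixes f :: "real \<Rightarrow> real"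
  assumes "continuous_on {c..d} f"
  shows "bdd_above (f ` {c..d})"
proof (cases "c \<le> d")
  case True
  then obtain x where "\<forall>y\<in>{c..d}. f y \<le> f x"
    using continuous_attains_sup[OF compact_Icc _ assms] by auto
  then show ?thesis by (auto intro: bdd_aboveI)
qed simp

text \<open>The right-hand side is strictly increasing in \<open>l\<close>, lies below \<open>a\<close> at \<open>l = 0\<close>, and above \<open>a\<close>
  at \<open>l = a\<close>.\<close>

lemma ex1_characteristic_exponent:
  fixes a b \<alpha> r :: real
  assumes "b > 0" "\<alpha> > 0" "r > 0" "a > b + \<alpha>"
  shows "\<exists>!l. a = b * exp (l * r) + l + \<alpha>"
proof -
  define f where "f l = b * exp (l * r) + l + \<alpha>" for l
  have mono: "f x < f y" if "x < y" for x y
    using that assms by (auto simp: f_def intro!: add_strict_mono)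
  have "\<exists>l\<ge>0. l \<le> a \<and> f l = a"
    by (rule IVT') (use assms in \<open>auto simp: f_def intro!: continuous_intros\<close>)
  then obtain l where "f l = a" by blast
  moreover have "k = l" if "f k = a" for k
    using mono[of k l] mono[of l k] that \<open>f l = a\<close> by (cases k l rule: linorder_cases) auto
  ultimately show ?thesis unfolding f_def by metis
qed

lemma characteristic_exponent_pos:
  fixes a b \<alpha> r l :: real
  assumes "b > 0" "r > 0" "a > b + \<alpha>" and l: "a = b * exp (l * r) + l + \<alpha>"
  shows "l > 0"
proof (rule ccontr)
  assume "\<not> l > 0"
  then have "exp (l * r) \<le> 1" using assms by (simp add: mult_le_0_iff)
  then have "b * exp (l * r) \<le> b" using assms by simp
  with \<open>\<not> l > 0\<close> assms show False by linarith
qed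

text \<open>Hypothesis \<open>rate\<close> makes \<open>K * exp (- \<eta> * t)\<close> a supersolution: its three summands absorb the
  delayed term, the slope of the exponential and the forcing term. A rate up to \<open>\<beta>\<close> is needed for
  the exponential to decay no faster than the forcing term.\<close>

lemma exponential_bound:
  fixes a b \<alpha> \<beta> \<eta> r K :: real and v :: "real \<Rightarrow> real"
  assumes "b > 0" "\<alpha> > 0" "r > 0" "0 \<le> \<eta>" "\<eta> \<le> \<beta>"
    and rate: "b * exp (\<eta> * r) + \<eta> + \<alpha> \<le> a"
    and cont: "continuous_on {-r..} v"
    and nonneg: "\<And>t. t \<ge> -r \<Longrightarrow> v t \<ge> 0"
    and dini: "\<And>t. t \<ge> 0 \<Longrightarrow>
           upper_Dini v t \<le> ereal (- a * v t + b * (SUP s\<in>{-r..0}. v (t + s))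
                                    + \<alpha> * init_norm r v * exp (- \<beta> * t))"
    and K: "init_norm r v < K"
    and "t \<ge> 0"
  shows "v t \<le> K * exp (- \<eta> * t)"
proof -
  define w where "w t = K * exp (- \<eta> * t)" for t
  have init: "v s \<le> init_norm r v" if "s \<in> {-r..0}" for s
    unfolding init_norm_def using that
    by (intro cSUP_upper bdd_above_image_Icc continuous_on_subset[OF cont]) auto
  have N: "0 \<le> init_norm r v"
    using init[of 0] nonneg[of 0] \<open>r > 0\<close> by simp
  with K have "K > 0" by simp
  \<comment> \<open>The delayed supremum can reach back before time 0, where \<open>w \<ge> K\<close> dominates the initial data.\<close>
  have past: "v s \<le> w s" if "s \<in> {-r..0}" for s
  proof -
    have "1 \<le> exp (- \<eta> * s)" using that \<open>0 \<le> \<eta>\<close> by (simp add: mult_nonneg_nonpos)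
    then have "K * 1 \<le> w s" unfolding w_def using \<open>K > 0\<close> by (intro mult_left_mono) auto
    with init[OF that] K show ?thesis by simp
  qed
  have "v t \<le> w t"
  proof (rule Dini_comparison[where v = v and w = w and x = t and w' = "\<lambda>t. - \<eta> * w t"])
    show "continuous_on {0..} v" using cont by (rule continuous_on_subset) (use \<open>r > 0\<close> in auto)
    show "(w has_real_derivative - \<eta> * w s) (at s)" for s
      unfolding w_def by (auto intro!: derivative_eq_intros)
    show "v 0 \<le> w 0" using past \<open>r > 0\<close> by simp
    show "t \<ge> 0" by fact
  next
    fix t assume "t \<ge> 0" and le: "\<And>s. s \<in> {0..t} \<Longrightarrow> v s \<le> w s" and eq: "v t = w t"
    have "w t > 0" using \<open>K > 0\<close> by (simp add: w_def)
    have "(SUP s\<in>{-r..0}. v (t + s)) \<le> exp (\<eta> * r) * w t"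
    proof (rule cSUP_least)
      fix s assume s: "s \<in> {-r..0}"
      then have "v (t + s) \<le> w (t + s)"
        using le[of "t + s"] past[of "t + s"] \<open>t \<ge> 0\<close> by (cases "t + s \<ge> 0") auto
      also have "\<dots> = exp (\<eta> * (- s)) * w t"
        by (simp add: w_def algebra_simps flip: exp_add)
      also have "\<dots> \<le> exp (\<eta> * r) * w t"
        using s \<open>0 \<le> \<eta>\<close> \<open>w t > 0\<close>
        by (intro mult_right_mono iffD2[OF exp_le_cancel_iff] mult_left_mono) auto
      finally show "v (t + s) \<le> exp (\<eta> * r) * w t" .
    qed (use \<open>r > 0\<close> in simp)
    then have delay: "b * (SUP s\<in>{-r..0}. v (t + s)) \<le> b * exp (\<eta> * r) * w t"
      using \<open>b > 0\<close> by (simp add: mult.assoc)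
    have "init_norm r v * exp (- \<beta> * t) \<le> init_norm r v * exp (- \<eta> * t)"
      using N \<open>\<eta> \<le> \<beta>\<close> \<open>t \<ge> 0\<close> by (intro mult_left_mono) (auto intro: mult_right_mono)
    also have "\<dots> < w t" using K by (simp add: w_def)
    finally have forcing: "\<alpha> * init_norm r v * exp (- \<beta> * t) < \<alpha> * w t"
      using \<open>\<alpha> > 0\<close> by (simp add: mult.assoc)
    have "(b * exp (\<eta> * r) + \<eta> + \<alpha>) * w t \<le> a * w t"
      using rate \<open>w t > 0\<close> by (intro mult_right_mono) auto
    with delay forcing
    have "- a * v t + b * (SUP s\<in>{-r..0}. v (t + s)) + \<alpha> * init_norm r v * exp (- \<beta> * t)
            < - \<eta> * w t"
      unfolding eq by (simp add: algebra_simps)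
    with dini[OF \<open>t \<ge> 0\<close>] show "upper_Dini v t < ereal (- \<eta> * w t)"
      by (meson le_less_trans ereal_less_eq less_ereal.simps(1))
  qed
  then show ?thesis by (simp add: w_def)
qed

theorem lemma1:
  fixes a b \<alpha> \<beta> r :: real and v :: "real \<Rightarrow> real"
  assumes "a > 0" and "b > 0" and "\<alpha> > 0" and "\<beta> > 0" and "r > 0"
    and "a > b + \<alpha>"
    and "continuous_on {-r..} v"
    and "\<And>t. t \<ge> -r \<Longrightarrow> v t \<ge> 0"
    and "\<And>t. t \<ge> 0 \<Longrightarrow>
           upper_Dini v t \<le> ereal (- a * v t + b * (SUP s\<in>{-r..0}. v (t + s))
                                    + \<alpha> * init_norm r v * exp (- \<beta> * t))"
  shows "(\<exists>!l::real. a = b * exp (l * r) + l + \<alpha>) \<and>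
         (\<forall>l::real. a = b * exp (l * r) + l + \<alpha> \<longrightarrow>
            (\<forall>t\<ge>0. v t \<le> init_norm r v * exp (- min l \<beta> * t)))"
proof (intro conjI allI impI)
  show "\<exists>!l. a = b * exp (l * r) + l + \<alpha>"
    using assms by (intro ex1_characteristic_exponent)
next
  fix l t :: real
  assume l: "a = b * exp (l * r) + l + \<alpha>" and "t \<ge> 0"
  define \<eta> where "\<eta> = min l \<beta>"
  have "l > 0" using characteristic_exponent_pos assms l by blast
  have "\<eta> \<ge> 0" "\<eta> \<le> \<beta>" "\<eta> \<le> l"
    using \<open>l > 0\<close> \<open>\<beta> > 0\<close> by (auto simp: \<eta>_def)
  have "b * exp (\<eta> * r) \<le> b * exp (l * r)"
    using \<open>\<eta> \<le> l\<close> \<open>b > 0\<close> \<open>r > 0\<close> by simp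
  with l \<open>\<eta> \<le> l\<close> have rate: "b * exp (\<eta> * r) + \<eta> + \<alpha> \<le> a" by linarith
  have "v t * exp (\<eta> * t) \<le> init_norm r v"
  proof (rule dense_ge)
    fix K assume "init_norm r v < K"
    with assms rate \<open>\<eta> \<ge> 0\<close> \<open>\<eta> \<le> \<beta>\<close> \<open>t \<ge> 0\<close> have "v t \<le> K * exp (- \<eta> * t)"
      by (intro exponential_bound)
    then show "v t * exp (\<eta> * t) \<le> K" by (simp add: exp_minus field_simps)
  qed
  then show "v t \<le> init_norm r v * exp (- min l \<beta> * t)"
    unfolding \<eta>_def[symmetric] by (simp add: exp_minus field_simps)
qed

end
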